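(* If $G$ is a comparability graph such that $\mathcal{C}_G$ has $k$ equivalence classes, then $G$ has exactly $2^k$ quasi-transitive orientations.
   Context: A comparability graph is a graph admitting a transitive orientation. A quasi-transitive orientation of a graph $G$ is an orientation of its edges such that whenever $u\to v$ and $v\to w$ are arcs with $u\neq w$, the vertices $u$ and $w$ are adjacent. A quasi-transitive $2$-edge-colouring of $G$ is a map $c: E(G)\to\{R,B\}$ such that for all pairs of edges $xy, yz \in E(G)$ with $c(xy)\neq c(yz)$, we have $xz\in E(G)$. $\mathcal{C}_G$ is the equivalence relation on $E(G)$ with $e\sim f$ iff $c(e)=c(f)$ for every quasi-transitive $2$-edge-colouring $c$ of $G$. *)

theory Defs
  imports Main
begin

definition simple_graph :: "'a set \<Rightarrow> 'a set set \<Rightarrow> bool" where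
  "simple_graph V E \<longleftrightarrow> (\<forall>e\<in>E. e \<subseteq> V \<and> card e = 2)"

definition orientation :: "'a set set \<Rightarrow> ('a \<times> 'a) set \<Rightarrow> bool" where
  "orientation E D \<longleftrightarrow>
     (\<forall>u v. (u, v) \<in> D \<longrightarrow> {u, v} \<in> E) \<and>
     (\<forall>u v. {u, v} \<in> E \<longrightarrow> ((u, v) \<in> D) \<noteq> ((v, u) \<in> D))"

definition transitive_orientation :: "'a set set \<Rightarrow> ('a \<times> 'a) set \<Rightarrow> bool" where
  "transitive_orientation E D \<longleftrightarrow> orientation E D \<and> trans D"

definition comparability_graph :: "'a set \<Rightarrow> 'a set set \<Rightarrow> bool" where
  "comparability_graph V E \<longleftrightarrow> simple_graph V E \<and> (\<exists>D. transitive_orientation E D)"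

definition quasi_transitive_orientation :: "'a set set \<Rightarrow> ('a \<times> 'a) set \<Rightarrow> bool" where
  "quasi_transitive_orientation E D \<longleftrightarrow> orientation E D \<and>
     (\<forall>u v w. (u, v) \<in> D \<and> (v, w) \<in> D \<and> u \<noteq> w \<longrightarrow> {u, w} \<in> E)"

datatype colour = Red | Blue

text \<open>Colourings are total functions, but only their values on \<open>E\<close> matter below.
  If \<open>x = z\<close>, the two edges coincide and the condition is vacuous.\<close>

definition quasi_transitive_colouring :: "'a set set \<Rightarrow> ('a set \<Rightarrow> colour) \<Rightarrow> bool" where
  "quasi_transitive_colouring E c \<longleftrightarrow>
     (\<forall>x y z. {x, y} \<in> E \<and> {y, z} \<in> E \<and> c {x, y} \<noteq> c {y, z} \<longrightarrow> {x, z} \<in> E)"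

definition colour_rel :: "'a set set \<Rightarrow> ('a set \<times> 'a set) set" where
  "colour_rel E = {(e, f). e \<in> E \<and> f \<in> E \<and>
     (\<forall>c. quasi_transitive_colouring E c \<longrightarrow> c e = c f)}"

lemma equiv_colour_rel: "equiv E (colour_rel E)"
  by (rule equivI) (auto simp: colour_rel_def refl_on_def sym_def trans_def)

end

theory Submission
  imports Defs
begin

text \<open>Fix a transitive orientation \<open>T\<close>. An orientation is determined by the set \<open>U\<close> of edges on
  which it agrees with \<open>T\<close>. If \<open>xy\<close> and \<open>yz\<close> are edges but \<open>xz\<close> is not, then \<open>T\<close> directs both of
  them into \<open>y\<close> or both out of \<open>y\<close>; so the orientation is quasi-transitive at \<open>x, y, z\<close> iff \<open>U\<close>
  contains both edges or neither, that is, iff the 2-colouring with colour classes \<open>U\<close> and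
  \<open>E - U\<close> is quasi-transitive there. Since \<open>xy\<close> and \<open>yz\<close> have the same colour in every
  quasi-transitive colouring, the quasi-transitive colourings are precisely the maps that are
  constant on the classes of \<open>colour_rel E\<close>, so the admissible \<open>U\<close> are the unions of classes.\<close>

lemma orientationD:
  assumes "orientation E D"
  shows "(u, v) \<in> D \<Longrightarrow> {u, v} \<in> E"
    and "{u, v} \<in> E \<Longrightarrow> (v, u) \<in> D \<longleftrightarrow> (u, v) \<notin> D"
proof -
  show "(u, v) \<in> D \<Longrightarrow> {u, v} \<in> E"
    using assms[unfolded orientation_def, THEN conjunct1] by blast
  assume "{u, v} \<in> E"
  then have "((u, v) \<in> D) \<noteq> ((v, u) \<in> D)"
    by (rule assms[unfolded orientation_def, THEN conjunct2, rule_format])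
  then show "(v, u) \<in> D \<longleftrightarrow> (u, v) \<notin> D" by argo
qed

lemma transitive_imp_quasi_transitive_orientation:
  assumes "transitive_orientation E D"
  shows "quasi_transitive_orientation E D"
proof -
  have o: "orientation E D" and "trans D"
    using assms by (auto simp: transitive_orientation_def)
  then have "{u, w} \<in> E" if "(u, v) \<in> D" "(v, w) \<in> D" for u v w
    using orientationD(1)[OF o] transD[OF \<open>trans D\<close> that] by blast
  with o show ?thesis
    unfolding quasi_transitive_orientation_def by blast
qed

text \<open>A directed path through \<open>y\<close> is exactly what non-adjacent \<open>x\<close>,
  \<open>z\<close> forbid, so their edges both enter or both leave \<open>y\<close>. Comparing the
  entering arcs suffices, since each edge has exactly one direction.\<close>

lemma quasi_transitive_orientation_iff:
  assumes "orientation E D"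
  shows "quasi_transitive_orientation E D \<longleftrightarrow>
    (\<forall>x y z. {x, y} \<in> E \<and> {y, z} \<in> E \<and> x \<noteq> z \<and> {x, z} \<notin> E \<longrightarrow>
      ((x, y) \<in> D \<longleftrightarrow> (z, y) \<in> D))" (is "_ \<longleftrightarrow> ?R")
proof
  assume Q: "quasi_transitive_orientation E D"
  show ?R
  proof (intro allI impI)
    fix x y z
    assume H: "{x, y} \<in> E \<and> {y, z} \<in> E \<and> x \<noteq> z \<and> {x, z} \<notin> E"
    then have "{z, x} \<notin> E" by (simp add: insert_commute)
    with H have "\<not> ((x, y) \<in> D \<and> (y, z) \<in> D)" "\<not> ((z, y) \<in> D \<and> (y, x) \<in> D)"
      using Q unfolding quasi_transitive_orientation_def by metis+
    with H show "(x, y) \<in> D \<longleftrightarrow> (z, y) \<in> D"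
      using orientationD(2)[OF assms, of x y] orientationD(2)[OF assms, of y z] by blast
  qed
next
  assume R: ?R
  have "{u, w} \<in> E" if "(u, v) \<in> D" "(v, w) \<in> D" "u \<noteq> w" for u v w
    using that R orientationD[OF assms] by metis
  with assms show "quasi_transitive_orientation E D"
    unfolding quasi_transitive_orientation_def by blast
qed

lemma quasi_transitive_colouring_iff_colour_rel:
  "quasi_transitive_colouring E c \<longleftrightarrow> (\<forall>(e, f) \<in> colour_rel E. c e = c f)"
proof
  show "quasi_transitive_colouring E c \<Longrightarrow> \<forall>(e, f) \<in> colour_rel E. c e = c f"
    by (auto simp: colour_rel_def)
next
  assume R: "\<forall>(e, f) \<in> colour_rel E. c e = c f"
  show "quasi_transitive_colouring E c"
    unfolding quasi_transitive_colouring_def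
  proof (intro allI impI, rule ccontr)
    fix x y z
    assume H: "{x, y} \<in> E \<and> {y, z} \<in> E \<and> c {x, y} \<noteq> c {y, z}" and "{x, z} \<notin> E"
    \<comment> \<open>As \<open>{x, z}\<close> is no edge, a colouring that separates these two
      edges is not quasi-transitive.\<close>
    then have "({x, y}, {y, z}) \<in> colour_rel E"
      unfolding colour_rel_def quasi_transitive_colouring_def by blast
    with R H show False by blast
  qed
qed

definition indicator_colouring :: "'a set set \<Rightarrow> 'a set \<Rightarrow> colour" where
  "indicator_colouring U e = (if e \<in> U then Red else Blue)"

lemma indicator_colouring_eq_iff:
  "indicator_colouring U e = indicator_colouring U f \<longleftrightarrow> (e \<in> U \<longleftrightarrow> f \<in> U)"
  by (simp add: indicator_colouring_def)

text \<open>For an orientation \<open>T\<close> of a simple graph, this will be the bijection from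
  \<open>Pow E\<close> to the orientations of \<open>E\<close>.\<close>

definition reorient :: "('a \<times> 'a) set \<Rightarrow> 'a set set \<Rightarrow> ('a \<times> 'a) set" where
  "reorient T U = {(u, v). if {u, v} \<in> U then (u, v) \<in> T else (v, u) \<in> T}"

lemma orientation_reorient:
  assumes "orientation E T"
  shows "orientation E (reorient T U)"
  unfolding orientation_def
proof (intro conjI allI impI)
  fix u v
  show "{u, v} \<in> E" if "(u, v) \<in> reorient T U"
    using that orientationD(1)[OF assms, of u v] orientationD(1)[OF assms, of v u]
    by (auto simp: reorient_def insert_commute split: if_splits)
  show "((u, v) \<in> reorient T U) \<noteq> ((v, u) \<in> reorient T U)" if "{u, v} \<in> E"
    using orientationD(2)[OF assms that] by (simp add: reorient_def insert_commute)
qed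

lemma reorient_iff:
  assumes "orientation E T" "{u, v} \<in> E"
  shows "(u, v) \<in> reorient T U \<longleftrightarrow> ((u, v) \<in> T \<longleftrightarrow> {u, v} \<in> U)"
  using orientationD(2)[OF assms] by (simp add: reorient_def)

lemma orientation_edgeE:
  assumes "orientation E T" "e \<in> E" "simple_graph V E"
  obtains u v where "e = {u, v}" "(u, v) \<in> T"
proof -
  obtain u v where "e = {u, v}"
    using assms(2,3) unfolding simple_graph_def by (metis card_2_iff)
  then show ?thesis
    using that assms(1,2) orientationD(2)[OF assms(1), of u v] by (metis insert_commute)
qed

text \<open>The set can be read off: the arc that \<open>T\<close> gives to an edge survives iff the
  edge is in the set.\<close>

lemma inj_on_reorient:
  assumes "orientation E T" "simple_graph V E"
  shows "inj_on (reorient T) (Pow E)"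
proof (rule inj_onI)
  fix U W assume UW: "U \<in> Pow E" "W \<in> Pow E" and eq: "reorient T U = reorient T W"
  have "e \<in> U \<longleftrightarrow> e \<in> W" if "e \<in> E" for e
    using orientation_edgeE[OF assms(1) that assms(2)] reorient_iff[OF assms(1)] eq that by metis
  with UW show "U = W" by blast
qed

lemma orientation_eq_reorient:
  assumes T: "orientation E T" and D: "orientation E D"
  shows "D = reorient T {{u, v} | u v. (u, v) \<in> D \<inter> T}" (is "D = reorient T ?U")
proof -
  \<comment> \<open>A doubleton forgets its order, so either arc may have put it into
    \<open>?U\<close>.\<close>
  have U: "{u, v} \<in> ?U \<longleftrightarrow> (u, v) \<in> D \<inter> T \<or> (v, u) \<in> D \<inter> T" for u v
    by (auto simp: doubleton_eq_iff)
  have "(u, v) \<in> D \<longleftrightarrow> (u, v) \<in> reorient T ?U" if "{u, v} \<in> E" for u v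
    unfolding reorient_iff[OF T that] U
    using orientationD(2)[OF T that] orientationD(2)[OF D that] by blast
  then show ?thesis
    using orientationD(1)[OF D] orientationD(1)[OF orientation_reorient[OF T]]
    by (intro subset_antisym subrelI) blast+
qed

lemma quasi_transitive_reorient_iff:
  assumes T: "quasi_transitive_orientation E T"
  shows "quasi_transitive_orientation E (reorient T U) \<longleftrightarrow>
    quasi_transitive_colouring E (indicator_colouring U)"
proof -
  have o: "orientation E T"
    using T by (simp add: quasi_transitive_orientation_def)
  have "((x, y) \<in> reorient T U \<longleftrightarrow> (z, y) \<in> reorient T U) \<longleftrightarrow> ({x, y} \<in> U \<longleftrightarrow> {y, z} \<in> U)"
    if "{x, y} \<in> E" "{y, z} \<in> E" "x \<noteq> z" "{x, z} \<notin> E" for x y z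
  proof -
    \<comment> \<open>By \<open>reorient_iff\<close>, both memberships are compared with this same
      truth value, which therefore cancels.\<close>
    have "(x, y) \<in> T \<longleftrightarrow> (z, y) \<in> T"
      using T that unfolding quasi_transitive_orientation_iff[OF o] by blast
    then show ?thesis
      using reorient_iff[OF o, of x y U] reorient_iff[OF o, of z y U] that
      by (auto simp: insert_commute)
  qed
  then have "quasi_transitive_orientation E (reorient T U) \<longleftrightarrow>
      (\<forall>x y z. {x, y} \<in> E \<and> {y, z} \<in> E \<and> x \<noteq> z \<and> {x, z} \<notin> E \<longrightarrow>
        ({x, y} \<in> U \<longleftrightarrow> {y, z} \<in> U))"
    unfolding quasi_transitive_orientation_iff[OF orientation_reorient[OF o]] by blast
  also have "\<dots> \<longleftrightarrow> quasi_transitive_colouring E (indicator_colouring U)"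
  proof -
    \<comment> \<open>The colouring condition does not exclude \<open>x = z\<close>; there the two
      edges coincide and have one colour.\<close>
    have "{x, y} \<in> U \<longleftrightarrow> {y, z} \<in> U" if "x = z" for x y z
      using that by (simp add: insert_commute)
    then show ?thesis
      unfolding quasi_transitive_colouring_def indicator_colouring_eq_iff by blast
  qed
  finally show ?thesis .
qed

text \<open>Classes are non-empty, so a class in one family meets a class of the other when the
  unions agree; by disjointness the two are equal.\<close>

lemma inj_on_Union_quotient:
  assumes "equiv A r"
  shows "inj_on Union (Pow (A // r))"
proof -
  have "C \<in> S'"
    if S: "S \<subseteq> A // r" "S' \<subseteq> A // r" "\<Union>S = \<Union>S'" "C \<in> S" for S S' C
  proof -
    have "C \<in> A // r" using S by blast
    moreover from this obtain e where "e \<in> C"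
      using in_quotient_imp_non_empty[OF assms] by blast
    moreover from this obtain C' where "C' \<in> S'" "e \<in> C'" using S by blast
    ultimately show ?thesis
      using quotient_disj[OF assms, of C C'] S by blast
  qed
  then have "S \<subseteq> S'" if "S \<subseteq> A // r" "S' \<subseteq> A // r" "\<Union>S = \<Union>S'" for S S'
    using that by (meson subsetI)
  then show ?thesis
    by (intro inj_onI subset_antisym) simp_all
qed

lemma saturated_eq_Union_quotient:
  assumes "equiv A r" "U \<subseteq> A"
  shows "(\<forall>(e, f) \<in> r. e \<in> U \<longleftrightarrow> f \<in> U) \<longleftrightarrow> U \<in> Union ` Pow (A // r)"
proof
  assume sat: "\<forall>(e, f) \<in> r. e \<in> U \<longleftrightarrow> f \<in> U"
  \<comment> \<open>\<open>U // r\<close> consists of the classes of elements of \<open>U\<close>: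
    they cover \<open>U\<close> by reflexivity and stay inside it by saturation.\<close>
  have "U = \<Union> (U // r)"
    using sat equiv_class_self[OF assms(1)] assms(2) by (fastforce simp: quotient_def)
  moreover have "U // r \<subseteq> A // r" using assms(2) by (auto simp: quotient_def)
  ultimately show "U \<in> Union ` Pow (A // r)" by blast
next
  assume "U \<in> Union ` Pow (A // r)"
  then obtain S where S: "S \<subseteq> A // r" "U = \<Union>S" by blast
  have "f \<in> U" if "(e, f) \<in> r" "e \<in> U" for e f
    using that S in_quotient_imp_closed[OF assms(1)] by blast
  moreover have "sym r" using assms(1) by (simp add: equiv_def)
  ultimately show "\<forall>(e, f) \<in> r. e \<in> U \<longleftrightarrow> f \<in> U" by (auto dest: symD)
qed

theorem theorem32:
  fixes V :: "'a set" and E :: "'a set set" and k :: nat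
  assumes "comparability_graph V E"
    and "finite (E // colour_rel E)"
    and "card (E // colour_rel E) = k"
  shows "card {D. quasi_transitive_orientation E D} = 2 ^ k"
proof -
  obtain T where G: "simple_graph V E" and "transitive_orientation E T"
    using assms(1) unfolding comparability_graph_def by blast
  then have T: "quasi_transitive_orientation E T"
    by (simp add: transitive_imp_quasi_transitive_orientation)
  then have o: "orientation E T"
    by (simp add: quasi_transitive_orientation_def)
  let ?\<U> = "Union ` Pow (E // colour_rel E)"
  have \<U>: "?\<U> \<subseteq> Pow E"
    using Union_quotient[OF equiv_colour_rel] by blast
  have iff: "quasi_transitive_orientation E (reorient T U) \<longleftrightarrow> U \<in> ?\<U>" if "U \<subseteq> E" for U
    unfolding quasi_transitive_reorient_iff[OF T]
      quasi_transitive_colouring_iff_colour_rel indicator_colouring_eq_iff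
    by (rule saturated_eq_Union_quotient[OF equiv_colour_rel that])
  have "{D. quasi_transitive_orientation E D} = reorient T ` ?\<U>"
  proof (intro subset_antisym subsetI)
    fix D assume "D \<in> {D. quasi_transitive_orientation E D}"
    then have q: "quasi_transitive_orientation E D" by simp
    then have D: "orientation E D" by (simp add: quasi_transitive_orientation_def)
    \<comment> \<open>The edges on which \<open>D\<close> and \<open>T\<close> agree.\<close>
    let ?U = "{{u, v} | u v. (u, v) \<in> D \<inter> T}"
    have "?U \<subseteq> E" using orientationD(1)[OF o] by blast
    moreover have eq: "D = reorient T ?U" by (rule orientation_eq_reorient[OF o D])
    ultimately have "?U \<in> ?\<U>" using iff[of ?U] q by simp
    with eq show "D \<in> reorient T ` ?\<U>" by (rule image_eqI)
  next
    fix D assume "D \<in> reorient T ` ?\<U>"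
    then obtain U where "U \<in> ?\<U>" "D = reorient T U" by blast
    then show "D \<in> {D. quasi_transitive_orientation E D}" using iff \<U> by blast
  qed
  \<comment> \<open>Two injections, from sets of classes to their unions and from these to
    orientations, reduce the count to sets of classes.\<close>
  also have "card \<dots> = card ?\<U>"
    by (rule card_image[OF inj_on_subset[OF inj_on_reorient[OF o G] \<U>]])
  also have "\<dots> = card (Pow (E // colour_rel E))"
    by (rule card_image[OF inj_on_Union_quotient[OF equiv_colour_rel]])
  \<comment> \<open>Finiteness matters: for infinitely many classes both cardinalities default to 0,
    whereas \<open>2 ^ 0\<close> is 1.\<close>
  also have "\<dots> = 2 ^ k"
    using assms(2,3) by (simp add: card_Pow)
  finally show ?thesis .
qed

end
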